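(* Let $d\ge 2$. For $i=1,2,\ldots,d$ let $V_{\ell_i}^{(i)}\in\mathbb{R}^{p_i\times\ell_i}$ have $1\le\ell_i<p_i$ orthonormal columns, and let $\mathcal{B}$ denote the set of matrices of the form $$B=B^{(d)}\otimes B^{(d-1)}\otimes\cdots\otimes B^{(1)},$$ where $B^{(i)}\in\mathbb{R}^{p_i\times n_i}$ and the range of $B^{(i)}$ is orthogonal to $\mathcal{R}(V_{\ell_i}^{(i)})$ for all $i$. Define the orthogonal projectors $$P=P^{(d)}\otimes P^{(d-1)}\otimes\cdots\otimes P^{(1)},\qquad P^{(i)}=I_{p_i}-V_{\ell_i}^{(i)}V_{\ell_i}^{(i)T},\quad i=1,2,\ldots,d.$$ Let $A=A^{(d)}\otimes A^{(d-1)}\otimes\cdots\otimes A^{(1)}$ with $A^{(i)}\in\mathbb{R}^{p_i\times n_i}$, $i=1,2,\ldots,d$. Then the matrix $\widehat{A}=PA$ is a closest matrix to $A$ in $\mathcal{B}$ in the Frobenius norm; that is, $\widehat{A}\in\mathcal{B}$ and $\|A-\widehat{A}\|_F\le\|A-B\|_F$ for all $B\in\mathcal{B}$.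
   Context: $\otimes$ denotes the Kronecker product of matrices, $\mathcal{R}(M)$ denotes the range (column space) of the matrix $M$, the superscript $^T$ denotes transposition, $I_k$ is the identity matrix of order $k$, and $\|M\|_F=\sqrt{\mathrm{trace}(M^TM)}$ is the Frobenius norm. *)

theory Defs
  imports Complex_Main "Jordan_Normal_Form.Matrix"
begin

text \<open>The block matrix whose block in position \<open>(r, s)\<close> is \<open>A $$ (r, s)\<close> times \<open>B\<close>.\<close>

definition kron :: "real mat \<Rightarrow> real mat \<Rightarrow> real mat" where
  "kron A B = mat (dim_row A * dim_row B) (dim_col A * dim_col B)
     (\<lambda>(r, s). A $$ (r div dim_row B, s div dim_col B) * B $$ (r mod dim_row B, s mod dim_col B))"

text \<open>\<open>kron_upto M d\<close> is \<open>M d \<otimes> M (d - 1) \<otimes> \<dots> \<otimes> M 1\<close>, with decreasing indices from left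
  to right. The empty product is the neutral 1-by-1 identity; \<open>M 0\<close> is never used.\<close>

primrec kron_upto :: "(nat \<Rightarrow> real mat) \<Rightarrow> nat \<Rightarrow> real mat" where
  "kron_upto M 0 = 1\<^sub>m 1"
| "kron_upto M (Suc k) = kron (M (Suc k)) (kron_upto M k)"

definition mat_range :: "real mat \<Rightarrow> real vec set" where
  "mat_range M = {M *\<^sub>v x | x. x \<in> carrier_vec (dim_col M)}"

definition orthogonal_spaces :: "real vec set \<Rightarrow> real vec set \<Rightarrow> bool" where
  "orthogonal_spaces X Y \<longleftrightarrow> (\<forall>x\<in>X. \<forall>y\<in>Y. x \<bullet> y = 0)"

definition orthonormal_columns :: "real mat \<Rightarrow> bool" where
  "orthonormal_columns V \<longleftrightarrow>
     (\<forall>r<dim_col V. \<forall>s<dim_col V. col V r \<bullet> col V s = (if r = s then 1 else 0))"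

definition mat_trace :: "real mat \<Rightarrow> real" where
  "mat_trace M = (\<Sum>r<dim_row M. M $$ (r, r))"

definition frobenius_norm :: "real mat \<Rightarrow> real" where
  "frobenius_norm M = sqrt (mat_trace (transpose_mat M * M))"

definition kron_orthogonal_class ::
  "nat \<Rightarrow> (nat \<Rightarrow> nat) \<Rightarrow> (nat \<Rightarrow> nat) \<Rightarrow> (nat \<Rightarrow> real mat) \<Rightarrow> real mat set" where
  "kron_orthogonal_class d p n V =
     {kron_upto B d | B. \<forall>i\<in>{1..d}. B i \<in> carrier_mat (p i) (n i) \<and>
        orthogonal_spaces (mat_range (B i)) (mat_range (V i))}"

lemma kron_one_right: "kron A (1\<^sub>m 1) = A"
  by (rule eq_matI) (simp_all add: kron_def)

lemma kron_upto_1: "kron_upto M 1 = M 1"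
  by (simp add: kron_one_right[simplified])

lemma kron_upto_2: "kron_upto M 2 = kron (M 2) (M 1)"
  by (simp add: numeral_2_eq_2 kron_one_right[simplified])

lemma kron_carrier:
  assumes "A \<in> carrier_mat a b" "B \<in> carrier_mat r s"
  shows "kron A B \<in> carrier_mat (a * r) (b * s)"
  using assms by (auto simp: kron_def)

lemma kron_upto_carrier:
  assumes "\<And>i. i \<in> {1..d} \<Longrightarrow> M i \<in> carrier_mat (p i) (n i)"
  shows "kron_upto M d \<in> carrier_mat (\<Prod>i=1..d. p i) (\<Prod>i=1..d. n i)"
  using assms
proof (induction d)
  case 0
  then show ?case by simp
next
  case (Suc d)
  then have "kron_upto M d \<in> carrier_mat (\<Prod>i=1..d. p i) (\<Prod>i=1..d. n i)"
    and "M (Suc d) \<in> carrier_mat (p (Suc d)) (n (Suc d))" by auto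
  then have "kron_upto M (Suc d)
      \<in> carrier_mat (p (Suc d) * (\<Prod>i=1..d. p i)) (n (Suc d) * (\<Prod>i=1..d. n i))"
    by (simp add: kron_carrier)
  then show ?case by (simp add: mult.commute)
qed

end

theory Submission
  imports Defs
begin

text \<open>
  By the mixed product rule, \<open>P A\<close> is the Kronecker product of the matrices \<open>P\<^sub>i A\<^sub>i\<close>, hence lies in
  the class, and \<open>P B = B\<close> for every \<open>B\<close> in the class. Therefore
  \<open>A - P A = (A - B) - P (A - B)\<close>, and subtracting from a matrix its image under a symmetric
  idempotent cannot increase the Frobenius norm.
\<close>

section \<open>Kronecker products: mixed product rule and transposition\<close>

text \<open>Division with remainder by \<open>q\<close> identifies the indices below
  \<open>m * q\<close> with pairs \<open>(i, j)\<close>, and a sum of products over such pairs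
  factors. The proof cuts the range into \<open>m\<close> blocks of length \<open>q\<close>, on each
  of which \<open>k div q\<close> is constant.\<close>

lemma sum_div_mod:
  fixes f g :: "nat \<Rightarrow> real"
  shows "(\<Sum>k<m * q. f (k div q) * g (k mod q)) = (\<Sum>i<m. f i) * (\<Sum>j<q. g j)"
proof -
  have block: "(\<Sum>k = i * q..<i * q + q. f (k div q) * g (k mod q)) = f i * (\<Sum>j<q. g j)" for i
  proof -
    \<comment> \<open>Shifting the block to start at 0 makes quotient and remainder explicit:
      \<open>j + i * q\<close> has quotient \<open>i\<close> and remainder \<open>j\<close>, because
      \<open>j < q\<close>.\<close>
    have "(\<Sum>k = i * q..<i * q + q. f (k div q) * g (k mod q))
        = (\<Sum>j<q. f ((j + i * q) div q) * g ((j + i * q) mod q))"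
      using sum.shift_bounds_nat_ivl[of "\<lambda>k. f (k div q) * g (k mod q)" 0 "i * q" q]
      by (simp add: atLeast0LessThan add.commute)
    also have "\<dots> = (\<Sum>j<q. f i * g j)"
      by (rule sum.cong) auto
    finally show ?thesis by (simp add: sum_distrib_left)
  qed
  show ?thesis
    by (simp add: sum.nat_group[symmetric] block sum_distrib_right)
qed

lemma mod_less_mult: "r < a * b \<Longrightarrow> r mod b < (b::nat)"
  by (cases "b = 0") auto

lemma kron_dims [simp]:
  "dim_row (kron A B) = dim_row A * dim_row B"
  "dim_col (kron A B) = dim_col A * dim_col B"
  by (simp_all add: kron_def)

lemma kron_index:
  assumes "r < dim_row A * dim_row B" "s < dim_col A * dim_col B"
  shows "kron A B $$ (r, s)
    = A $$ (r div dim_row B, s div dim_col B) * B $$ (r mod dim_row B, s mod dim_col B)"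
  using assms by (simp add: kron_def)

text \<open>The inner summation index encodes a block number and a position within the block, so by
  \<open>sum_div_mod\<close> each entry splits into an entry of \<open>A * C\<close> times an entry
  of \<open>B * D\<close>.\<close>

lemma kron_mult_kron:
  assumes "dim_col A = dim_row C" "dim_col B = dim_row D"
  shows "kron A B * kron C D = kron (A * C) (B * D)"
proof (rule eq_matI)
  fix r s
  assume "r < dim_row (kron (A * C) (B * D))" "s < dim_col (kron (A * C) (B * D))"
  then have r: "r < dim_row A * dim_row B" and s: "s < dim_col C * dim_col D" by simp_all
  have rb: "r div dim_row B < dim_row A" "r mod dim_row B < dim_row B"
    using r by (simp_all add: less_mult_imp_div_less mod_less_mult)
  have sb: "s div dim_col D < dim_col C" "s mod dim_col D < dim_col D"
    using s by (simp_all add: less_mult_imp_div_less mod_less_mult)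
  have "(kron A B * kron C D) $$ (r, s)
      = (\<Sum>k<dim_row C * dim_row D. kron A B $$ (r, k) * kron C D $$ (k, s))"
    using r s by (simp add: scalar_prod_def atLeast0LessThan assms)
  also have "\<dots> = (\<Sum>k<dim_row C * dim_row D.
      (A $$ (r div dim_row B, k div dim_row D) * C $$ (k div dim_row D, s div dim_col D))
      * (B $$ (r mod dim_row B, k mod dim_row D) * D $$ (k mod dim_row D, s mod dim_col D)))"
    using r s by (intro sum.cong) (simp_all add: kron_index assms mult_ac)
  also have "\<dots> = (\<Sum>i<dim_row C. A $$ (r div dim_row B, i) * C $$ (i, s div dim_col D))
      * (\<Sum>j<dim_row D. B $$ (r mod dim_row B, j) * D $$ (j, s mod dim_col D))"
    by (rule sum_div_mod)
  also have "\<dots> = kron (A * C) (B * D) $$ (r, s)"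
    using r s rb sb by (simp add: kron_index scalar_prod_def atLeast0LessThan assms)
  finally show "(kron A B * kron C D) $$ (r, s) = kron (A * C) (B * D) $$ (r, s)" .
qed simp_all

lemma transpose_kron: "transpose_mat (kron A B) = kron (transpose_mat A) (transpose_mat B)"
  by (rule eq_matI) (simp_all add: kron_index less_mult_imp_div_less mod_less_mult)

lemma kron_upto_mult:
  assumes "\<And>i. i \<in> {1..d} \<Longrightarrow> M i \<in> carrier_mat (a i) (b i)"
    and "\<And>i. i \<in> {1..d} \<Longrightarrow> N i \<in> carrier_mat (b i) (c i)"
  shows "kron_upto M d * kron_upto N d = kron_upto (\<lambda>i. M i * N i) d"
  using assms
proof (induction d)
  case (Suc d)
  \<comment> \<open>The sizes of the partial products are needed because the mixed product rule asks
    for matching inner dimensions.\<close>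
  have "kron_upto M d \<in> carrier_mat (\<Prod>i=1..d. a i) (\<Prod>i=1..d. b i)"
    by (intro kron_upto_carrier) (use Suc.prems in auto)
  moreover have "kron_upto N d \<in> carrier_mat (\<Prod>i=1..d. b i) (\<Prod>i=1..d. c i)"
    by (intro kron_upto_carrier) (use Suc.prems in auto)
  moreover have "M (Suc d) \<in> carrier_mat (a (Suc d)) (b (Suc d))"
    "N (Suc d) \<in> carrier_mat (b (Suc d)) (c (Suc d))"
    using Suc.prems by auto
  ultimately have "kron_upto M (Suc d) * kron_upto N (Suc d)
      = kron (M (Suc d) * N (Suc d)) (kron_upto M d * kron_upto N d)"
    by (simp add: kron_mult_kron)
  then show ?case
    using Suc by simp
qed simp

lemma transpose_kron_upto:
  "transpose_mat (kron_upto M d) = kron_upto (\<lambda>i. transpose_mat (M i)) d"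
  by (induction d) (simp_all add: transpose_kron)

text \<open>Allows factors to be rewritten by facts that are known only for indices in
  \<open>{1..d}\<close>.\<close>

lemma kron_upto_cong:
  "(\<And>i. i \<in> {1..d} \<Longrightarrow> M i = N i) \<Longrightarrow> kron_upto M d = kron_upto N d"
  by (induction d) simp_all

section \<open>Orthogonality of ranges as a matrix equation\<close>

text \<open>The entries of \<open>transpose_mat V * B\<close> are the inner products of columns of
  \<open>V\<close> with columns of \<open>B\<close>, and these columns span the two ranges. The
  equation is the form of the class condition that can be used in computations with
  projectors.\<close>

lemma orthogonal_spaces_mat_range_iff:
  assumes "B \<in> carrier_mat p n" "V \<in> carrier_mat p l"
  shows "orthogonal_spaces (mat_range B) (mat_range V) \<longleftrightarrow> transpose_mat V * B = 0\<^sub>m l n"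
proof
  assume orth: "orthogonal_spaces (mat_range B) (mat_range V)"
  have col_in_range: "col M j \<in> mat_range M" if "j < dim_col M" for M :: "real mat" and j
  proof -
    have "M *\<^sub>v unit_vec (dim_col M) j = col M j"
      using that by (intro eq_vecI) simp_all
    then show ?thesis unfolding mat_range_def by (force intro: sym)
  qed
  show "transpose_mat V * B = 0\<^sub>m l n"
  proof (rule eq_matI)
    fix r s assume "r < dim_row (0\<^sub>m l n :: real mat)" "s < dim_col (0\<^sub>m l n :: real mat)"
    then have rs: "r < l" "s < n" by simp_all
    then have "col B s \<bullet> col V r = 0"
      using orth assms by (auto simp: orthogonal_spaces_def intro: col_in_range)
    then show "(transpose_mat V * B) $$ (r, s) = 0\<^sub>m l n $$ (r, s)"
      using rs assms comm_scalar_prod[of "col B s" p "col V r"] by simp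
  qed (use assms in auto)
next
  assume zero: "transpose_mat V * B = 0\<^sub>m l n"
  have "(B *\<^sub>v u) \<bullet> (V *\<^sub>v w) = 0" if u: "u \<in> carrier_vec n" and w: "w \<in> carrier_vec l" for u w
  proof -
    \<comment> \<open>Moving \<open>V\<close> to the other side of the inner product as its adjoint
      brings out the vanishing product \<open>transpose_mat V * B\<close>.\<close>
    have "(B *\<^sub>v u) \<bullet> (V *\<^sub>v w) = (transpose_mat V *\<^sub>v (B *\<^sub>v u)) \<bullet> w"
      using assms u w by (simp add: transpose_vec_mult_scalar)
    also have "transpose_mat V *\<^sub>v (B *\<^sub>v u) = 0\<^sub>m l n *\<^sub>v u"
      using assms u zero by (simp flip: assoc_mult_mat_vec[of _ l p _ n])
    also have "\<dots> \<bullet> w = 0"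
    proof -
      have "0\<^sub>m l n *\<^sub>v u = (0\<^sub>v l :: real vec)"
        using u by (intro eq_vecI) simp_all
      then show ?thesis using w by simp
    qed
    finally show ?thesis .
  qed
  then show "orthogonal_spaces (mat_range B) (mat_range V)"
    using assms by (auto simp: orthogonal_spaces_def mat_range_def)
qed

lemma orthonormal_columns_transpose_mult:
  assumes "orthonormal_columns V"
  shows "transpose_mat V * V = 1\<^sub>m (dim_col V)"
  using assms by (intro eq_matI) (auto simp: orthonormal_columns_def)

section \<open>Frobenius norm and symmetric idempotents\<close>

text \<open>Each diagonal entry is the inner product of a column of \<open>M\<close> with itself,
  hence a sum of squares.\<close>

lemma mat_trace_transpose_mult_nonneg: "0 \<le> mat_trace (transpose_mat M * M)"
  unfolding mat_trace_def by (intro sum_nonneg) (auto simp: scalar_prod_def intro: sum_nonneg)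

lemma mat_trace_minus:
  assumes "M \<in> carrier_mat n n" "N \<in> carrier_mat n n"
  shows "mat_trace (M - N) = mat_trace M - mat_trace N"
  using assms by (simp add: mat_trace_def sum_subtractf)

text \<open>This is Pythagoras: for \<open>N = Q * M\<close>, symmetry and idempotence of
  \<open>Q\<close> make both cross terms equal to \<open>transpose_mat N * N\<close>. The squared
  norm of \<open>M - N\<close> is therefore that of \<open>M\<close> minus that of
  \<open>N\<close>.\<close>

lemma frobenius_norm_minus_projection_le:
  assumes M: "M \<in> carrier_mat m n" and Q: "Q \<in> carrier_mat m m"
    and sym: "transpose_mat Q = Q" and idem: "Q * Q = Q"
  shows "frobenius_norm (M - Q * M) \<le> frobenius_norm M"
proof -
  define N where "N = Q * M"
  have N: "N \<in> carrier_mat m n" using M Q by (simp add: N_def)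
  have tN: "transpose_mat N = transpose_mat M * Q"
    using M Q sym by (simp add: N_def transpose_mult)
  have MN: "transpose_mat N * M = transpose_mat M * N"
    unfolding tN using M Q by (simp add: N_def assoc_mult_mat[of _ n m _ m _ n])
  have "Q * N = N"
    unfolding N_def using M Q idem by (simp flip: assoc_mult_mat[of _ m m _ m _ n])
  then have NN: "transpose_mat N * N = transpose_mat M * N"
    unfolding tN using M N Q by (simp add: assoc_mult_mat[of _ n m _ m _ n])
  have "transpose_mat (M - N) * (M - N)
      = (transpose_mat M - transpose_mat N) * (M - N)"
    using M N by (simp add: transpose_minus)
  also have "\<dots> = (transpose_mat M * M - transpose_mat N * M)
      - (transpose_mat M * N - transpose_mat N * N)"
    using M N
    by (simp add: minus_carrier_mat minus_mult_distrib_mat[of _ n m _ _ n]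
        mult_minus_distrib_mat[of _ n m _ n])
  also have "\<dots> = transpose_mat M * M - transpose_mat N * N"
    unfolding MN NN using M N by (intro eq_matI) auto
  finally have "mat_trace (transpose_mat (M - N) * (M - N))
      = mat_trace (transpose_mat M * M) - mat_trace (transpose_mat N * N)"
    using M N by (simp add: mat_trace_minus[of _ n])
  then show ?thesis
    using mat_trace_transpose_mult_nonneg[of N] by (simp add: frobenius_norm_def N_def)
qed

section \<open>Projectors onto the orthogonal complement of a range\<close>

text \<open>The bracketing isolates \<open>transpose_mat V * B\<close>, the quantity that measures
  the failure of orthogonality.\<close>

lemma complement_projector_mult:
  fixes V B :: "real mat"
  assumes "V \<in> carrier_mat p l" "B \<in> carrier_mat p n"
  shows "(1\<^sub>m p - V * transpose_mat V) * B = B - V * (transpose_mat V * B)"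
  using assms by (simp add: minus_mult_distrib_mat[of _ p p])

lemma complement_projector_sym:
  fixes V :: "real mat"
  assumes "V \<in> carrier_mat p l"
  shows "transpose_mat (1\<^sub>m p - V * transpose_mat V) = 1\<^sub>m p - V * transpose_mat V"
  using assms by (simp add: transpose_minus[of _ p p] transpose_mult[of _ p l])

text \<open>Orthonormality cancels \<open>transpose_mat V * V\<close>, so the two terms of the
  expanded product agree. It serves both for membership of \<open>Ahat\<close> in the class and for
  idempotence of the projectors.\<close>

lemma transpose_mult_complement_projector:
  assumes V: "V \<in> carrier_mat p l" and "orthonormal_columns V" and B: "B \<in> carrier_mat p n"
  shows "transpose_mat V * ((1\<^sub>m p - V * transpose_mat V) * B) = 0\<^sub>m l n"
proof -
  have "transpose_mat V * (V * (transpose_mat V * B)) = transpose_mat V * B"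
    using assms orthonormal_columns_transpose_mult[of V]
    by (simp flip: assoc_mult_mat[of _ l p _ l _ n])
  then show ?thesis
    unfolding complement_projector_mult[OF V B]
    using V B by (simp add: mult_minus_distrib_mat[of _ l p _ n])
qed

text \<open>The correction term \<open>V * (transpose_mat V * B)\<close> vanishes.\<close>

lemma complement_projector_fixes:
  fixes V B :: "real mat"
  assumes V: "V \<in> carrier_mat p l" and B: "B \<in> carrier_mat p n"
    and "transpose_mat V * B = 0\<^sub>m l n"
  shows "(1\<^sub>m p - V * transpose_mat V) * B = B"
  unfolding complement_projector_mult[OF V B] using assms by (intro eq_matI) auto

theorem proposition3p2:
  fixes d :: nat
    and p n l :: "nat \<Rightarrow> nat"
    and V Afac Pfac :: "nat \<Rightarrow> real mat"
    and A P Ahat :: "real mat"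
  assumes "d \<ge> 2"
    and "\<And>i. i \<in> {1..d} \<Longrightarrow> 1 \<le> l i \<and> l i < p i"
    and "\<And>i. i \<in> {1..d} \<Longrightarrow> V i \<in> carrier_mat (p i) (l i)"
    and "\<And>i. i \<in> {1..d} \<Longrightarrow> orthonormal_columns (V i)"
    and "\<And>i. i \<in> {1..d} \<Longrightarrow> Pfac i = 1\<^sub>m (p i) - V i * transpose_mat (V i)"
    and "P = kron_upto Pfac d"
    and "\<And>i. i \<in> {1..d} \<Longrightarrow> Afac i \<in> carrier_mat (p i) (n i)"
    and "A = kron_upto Afac d"
    and "Ahat = P * A"
  shows "Ahat \<in> kron_orthogonal_class d p n V \<and>
    (\<forall>B \<in> kron_orthogonal_class d p n V. frobenius_norm (A - Ahat) \<le> frobenius_norm (A - B))"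
proof -
  note V = assms(3) and orth = assms(4) and Pf = assms(5) and Af = assms(7)
  define a where "a = (\<Prod>i=1..d. p i)"
  define b where "b = (\<Prod>i=1..d. n i)"
  have Pc: "Pfac i \<in> carrier_mat (p i) (p i)" if "i \<in> {1..d}" for i
    unfolding Pf[OF that] using V[OF that] by (intro minus_carrier_mat mult_carrier_mat) auto
  have P: "P \<in> carrier_mat a a"
    unfolding a_def assms(6) by (rule kron_upto_carrier) (rule Pc)
  have A: "A \<in> carrier_mat a b"
    unfolding a_def b_def assms(8) by (rule kron_upto_carrier) (rule Af)
  have sym: "transpose_mat P = P"
    unfolding assms(6) transpose_kron_upto
    by (rule kron_upto_cong) (simp only: Pf complement_projector_sym[OF V])
  have idem: "P * P = P"
  proof -
    have "P * P = kron_upto (\<lambda>i. Pfac i * Pfac i) d"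
      unfolding assms(6) by (rule kron_upto_mult) (rule Pc, assumption)+
    also have "\<dots> = P"
      unfolding assms(6)
    proof (rule kron_upto_cong)
      fix i assume i: "i \<in> {1..d}"
      \<comment> \<open>The identity matrix takes the place of a general right factor, which shows
        that the range of \<open>Pfac i\<close> is itself orthogonal to that of \<open>V i\<close>.
        Hence \<open>Pfac i\<close> fixes \<open>Pfac i\<close>, which is idempotence.\<close>
      have "transpose_mat (V i) * (Pfac i * 1\<^sub>m (p i)) = 0\<^sub>m (l i) (p i)"
        unfolding Pf[OF i]
        by (rule transpose_mult_complement_projector[OF V[OF i] orth[OF i]]) simp
      then have "transpose_mat (V i) * Pfac i = 0\<^sub>m (l i) (p i)"
        using right_mult_one_mat[OF Pc[OF i]] by simp
      from complement_projector_fixes[OF V[OF i] Pc[OF i] this]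
      show "Pfac i * Pfac i = Pfac i"
        by (simp only: Pf[OF i])
    qed
    finally show ?thesis .
  qed
  \<comment> \<open>The products \<open>Pfac i * Afac i\<close> are the witnesses for membership of
    \<open>Ahat\<close> in the class.\<close>
  have "Ahat = kron_upto (\<lambda>i. Pfac i * Afac i) d"
    unfolding assms(6,8,9) by (rule kron_upto_mult[OF Pc Af])
  moreover have "Pfac i * Afac i \<in> carrier_mat (p i) (n i)
      \<and> orthogonal_spaces (mat_range (Pfac i * Afac i)) (mat_range (V i))"
    if i: "i \<in> {1..d}" for i
  proof -
    have c: "Pfac i * Afac i \<in> carrier_mat (p i) (n i)" using Pc[OF i] Af[OF i] by simp
    have "transpose_mat (V i) * (Pfac i * Afac i) = 0\<^sub>m (l i) (n i)"
      unfolding Pf[OF i] by (rule transpose_mult_complement_projector[OF V[OF i] orth[OF i] Af[OF i]])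
    then show ?thesis
      using c orthogonal_spaces_mat_range_iff[OF c V[OF i]] by blast
  qed
  ultimately have "Ahat \<in> kron_orthogonal_class d p n V"
    unfolding kron_orthogonal_class_def by blast
  moreover have "frobenius_norm (A - Ahat) \<le> frobenius_norm (A - B)"
    if B_in: "B \<in> kron_orthogonal_class d p n V" for B
  proof -
    obtain Bfac where B_eq: "B = kron_upto Bfac d"
      and Bfac: "\<forall>i\<in>{1..d}. Bfac i \<in> carrier_mat (p i) (n i)
        \<and> orthogonal_spaces (mat_range (Bfac i)) (mat_range (V i))"
      using B_in unfolding kron_orthogonal_class_def by blast
    have Bc: "Bfac i \<in> carrier_mat (p i) (n i)"
      and Borth: "orthogonal_spaces (mat_range (Bfac i)) (mat_range (V i))"
      if "i \<in> {1..d}" for i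
      using Bfac that by blast+
    have B: "B \<in> carrier_mat a b"
      unfolding a_def b_def B_eq by (rule kron_upto_carrier) (rule Bc)
    have PB: "P * B = B"
    proof -
      have "P * B = kron_upto (\<lambda>i. Pfac i * Bfac i) d"
        unfolding assms(6) B_eq by (rule kron_upto_mult[OF Pc Bc])
      also have "\<dots> = B"
        unfolding B_eq
      proof (rule kron_upto_cong)
        fix i assume i: "i \<in> {1..d}"
        \<comment> \<open>The class condition on \<open>Bfac i\<close>, read as a matrix equation,
          says that the projector leaves this factor unchanged.\<close>
        show "Pfac i * Bfac i = Bfac i"
          unfolding Pf[OF i]
          using Borth[OF i] unfolding orthogonal_spaces_mat_range_iff[OF Bc[OF i] V[OF i]]
          by (rule complement_projector_fixes[OF V[OF i] Bc[OF i]])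
      qed
      finally show ?thesis .
    qed
    have Ahat: "Ahat \<in> carrier_mat a b"
      unfolding assms(9) using P A by simp
    have "P * (A - B) = Ahat - B"
      unfolding mult_minus_distrib_mat[OF P A B] PB assms(9) ..
    \<comment> \<open>Since \<open>Ahat - B\<close> is the projection of \<open>A - B\<close>, the
      norm bound applies with \<open>A - B\<close> in the role of \<open>M\<close>.\<close>
    moreover have "A - Ahat = (A - B) - (Ahat - B)"
      using Ahat A B by (intro eq_matI) auto
    ultimately show ?thesis
      using frobenius_norm_minus_projection_le[OF minus_carrier_mat[OF B] P sym idem, of A]
      by (simp only:)
  qed
  ultimately show ?thesis by blast
qed

end
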